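(* Let $r>1$ and $s>1$ be real numbers. Then $$\int_{\Pi^+} \frac {y^{2s-2}}{\left \vert x+i(y+1)\right \vert^{2rs}}\,dx\,dy\leq C_s \left (\int_{\Pi^+} \frac {dx\,dy}{\left \vert x+i(y+1)\right \vert^{2r}} \right )^s,$$ and equality holds if and only if $r=2$.
   Context: $\Pi^+=\{x+iy\in\mathbb{C}: y>0\}$ is the upper half-plane, and $C_s=\dfrac {\pi^{1-s}}{(2s-1)2^{2s-2}}$. *)

theory Defs
  imports "HOL-Analysis.Analysis"
begin

definition upper_half_plane :: "complex set" where
  "upper_half_plane = {z. Im z > 0}"

definition C_const :: "real \<Rightarrow> real" where
  "C_const s = pi powr (1 - s) / ((2 * s - 1) * 2 powr (2 * s - 2))"

text \<open>
  The area measure \<open>dx dy\<close> is \<^term>\<open>lborel :: complex measure\<close>, the Lebesgue--Borel measure for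
  the orthonormal basis \<open>{1, \<i>}\<close>, and a point of the half-plane is \<open>z = x + i y\<close> with \<open>x = Re z\<close>
  and \<open>y = Im z\<close>. The powers have real exponents, and their bases are positive on the half-plane.
\<close>

definition lhs_integrand :: "real \<Rightarrow> real \<Rightarrow> complex \<Rightarrow> real" where
  "lhs_integrand r s z =
     Im z powr (2 * s - 2) / cmod (Complex (Re z) (Im z + 1)) powr (2 * r * s)"

definition rhs_integrand :: "real \<Rightarrow> complex \<Rightarrow> real" where
  "rhs_integrand r z = 1 / cmod (Complex (Re z) (Im z + 1)) powr (2 * r)"

end

theory Submission
  imports Defs "HOL-Probability.Distributions"
begin

text \<open>
  Both integrals have a closed form in terms of the Gamma function. The identity
  \<open>\<Gamma>(a) \<rho>\<^sup>-\<^sup>a = \<integral> t\<^sup>a\<^sup>-\<^sup>1 e\<^sup>-\<^sup>\<rho>\<^sup>t dt\<close> and Tonelli's theorem turn the integral over \<open>x\<close> into a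
  Gaussian one and the integral over \<open>y\<close> into a Beta integral; Legendre's duplication formula then
  gives, for \<open>s \<ge> 1\<close>,

  \<open>LHS(r, s) = \<pi> 2\<^sup>2\<^sup>-\<^sup>2\<^sup>r\<^sup>s / (2s - 1) \<cdot> \<Gamma>(2s) \<Gamma>(s(2r - 2)) / \<Gamma>(sr)\<^sup>2\<close>

  (\<open>nn_integral_lhs_integrand\<close>). The integral on the right-hand side is the case \<open>s = 1\<close>. The
  powers of \<open>\<pi>\<close> and \<open>2\<close> and the factor \<open>2s - 1\<close> match on both sides, and since \<open>r\<close> is the midpoint
  of \<open>2\<close> and \<open>2r - 2\<close>, what remains after taking logarithms is

  \<open>G(2s, s(2r - 2)) \<le> s G(2, 2r - 2)\<close>, where
  \<open>G(a, b) = ln \<Gamma>(a) + ln \<Gamma>(b) - 2 ln \<Gamma>((a + b)/2)\<close>.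

  For \<open>r = 2\<close> both sides vanish. For \<open>r \<noteq> 2\<close> the inequality is strict: it says that
  \<open>D(x) = s ln \<Gamma>(x) - ln \<Gamma>(s x)\<close> is strictly midpoint convex (\<open>ln_Gamma_gap_scaled_less\<close>). Indeed
  \<open>D''(x) = s (\<psi>'(x) - s \<psi>'(s x))\<close> is positive for \<open>s > 1\<close>, because \<open>x \<psi>'(x)\<close> is strictly decreasing
  (\<open>mult_trigamma_strict_antimono\<close>).
\<close>

section \<open>Strict convexity of \<open>s ln \<Gamma>(x) - ln \<Gamma>(s x)\<close>\<close>

text \<open>
  The left-hand side is the derivative of \<open>x \<psi>'(x)\<close>, and its negative is the sum over \<open>u = x + k\<close> of
  \<open>2x/u\<^sup>3 - 1/u\<^sup>2\<close>. These terms are negative for large \<open>k\<close>, so a telescoping series with sum zero is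
  subtracted to make all of them positive. It comes from the integrals over \<open>[u, u + 1]\<close>: the trapezoidal
  rule for the convex function \<open>2/u\<^sup>3\<close> overestimates \<open>1/u\<^sup>2 - 1/(u + 1)\<^sup>2\<close>, and the right endpoint
  rule for the decreasing function \<open>1/u\<^sup>2\<close> underestimates \<open>1/u - 1/(u + 1)\<close>.
\<close>
lemma DERIV_mult_trigamma_neg:
  fixes x :: real
  assumes x: "x > 0"
  shows "Polygamma 1 x + x * Polygamma 2 x < 0"
proof -
  define g where "g k = x * (1 / (x + real k)^2 + 1 / (x + real k)^3)
      - (1 / (x + real k) + 1 / (x + real k)^2)" for k
  define f where "f k = x * (2 * inverse ((x + real k)^3)) - inverse ((x + real k)^2)" for k
  have S1: "(\<lambda>k. inverse ((x + real k)^2)) sums Polygamma 1 x"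
    using Polygamma_LIMSEQ[of x 1] x by (simp add: numeral_2_eq_2)
  have S2: "(\<lambda>k. inverse ((x + real k)^3)) sums (- Polygamma 2 x / 2)"
    using Polygamma_LIMSEQ[of x 2] x by (simp add: numeral_3_eq_3 numeral_2_eq_2)
  have "f sums (x * (2 * (- Polygamma 2 x / 2)) - Polygamma 1 x)"
    unfolding f_def by (intro sums_diff sums_mult S1 S2)
  moreover have "g \<longlonglongrightarrow> 0"
    unfolding g_def by real_asymp
  then have "(\<lambda>k. g k - g (Suc k)) sums (g 0 - 0)"
    by (rule telescope_sums')
  moreover have "g 0 = 0"
    using x by (simp add: g_def field_simps power2_eq_square power3_eq_cube)
  ultimately have sums: "(\<lambda>k. f k - (g k - g (Suc k))) sums
      (x * (2 * (- Polygamma 2 x / 2)) - Polygamma 1 x - 0)"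
    by (metis sums_diff diff_zero)
  have pos: "0 < f k - (g k - g (Suc k))" for k
  proof -
    define u where "u = x + real k"
    have u: "u > 0" using x by (simp add: u_def)
    have "f k - (g k - g (Suc k)) =
        x * (1 / u^3 + 1 / (u+1)^3 - (1 / u^2 - 1 / (u+1)^2)) + ((1 / u - 1 / (u+1)) - 1 / (u+1)^2)"
      by (simp add: f_def g_def u_def inverse_eq_divide algebra_simps)
    moreover have "1 / u^3 + 1 / (u+1)^3 - (1 / u^2 - 1 / (u+1)^2) = (2 * u + 1) / (u^3 * (u+1)^3)"
      using u by (simp add: divide_simps) algebra
    moreover have "(1 / u - 1 / (u+1)) - 1 / (u+1)^2 = 1 / (u * (u+1)^2)"
      using u by (simp add: divide_simps) algebra
    ultimately show ?thesis using x u by (simp add: add_pos_pos)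
  qed
  have "0 < (\<Sum>k. f k - (g k - g (Suc k)))"
    using sums pos by (intro suminf_pos) (auto simp: sums_iff)
  with sums show ?thesis by (simp add: sums_iff)
qed

lemma mult_trigamma_strict_antimono:
  fixes x y :: real
  assumes "0 < x" "x < y"
  shows "y * Polygamma 1 y < x * Polygamma 1 x"
proof (rule DERIV_neg_imp_decreasing[OF assms(2)])
  fix z assume "x \<le> z" "z \<le> y"
  with assms have z: "z > 0" by simp
  have "((\<lambda>z. z * Polygamma 1 z) has_real_derivative Polygamma 1 z + z * Polygamma 2 z) (at z)"
    using z by (auto intro!: derivative_eq_intros simp: numeral_2_eq_2 elim!: nonpos_Ints_cases)
  then show "\<exists>d. ((\<lambda>z. z * Polygamma 1 z) has_real_derivative d) (at z) \<and> d < 0"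
    using DERIV_mult_trigamma_neg[OF z] by blast
qed

lemma midpoint_less_if_deriv_strict_mono:
  fixes f f' :: "real \<Rightarrow> real"
  assumes "a < b"
    and deriv: "\<And>x. a \<le> x \<Longrightarrow> x \<le> b \<Longrightarrow> (f has_real_derivative f' x) (at x)"
    and mono: "\<And>x y. a \<le> x \<Longrightarrow> x < y \<Longrightarrow> y \<le> b \<Longrightarrow> f' x < f' y"
  shows "2 * f ((a + b) / 2) < f a + f b"
proof -
  let ?m = "(a + b) / 2"
  obtain x where x: "a < x" "x < ?m" "f ?m - f a = (?m - a) * f' x"
    using MVT2[of a ?m f f'] deriv \<open>a < b\<close> by force
  obtain y where y: "?m < y" "y < b" "f b - f ?m = (b - ?m) * f' y"
    using MVT2[of ?m b f f'] deriv \<open>a < b\<close> by force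
  have "f' x < f' y" using mono x y by simp
  then have "(b - a) / 2 * f' x < (b - a) / 2 * f' y"
    using \<open>a < b\<close> by simp
  moreover have "?m - a = (b - a) / 2" "b - ?m = (b - a) / 2" by (simp_all add: field_simps)
  ultimately have "f ?m - f a < f b - f ?m" unfolding x(3) y(3) by (simp only: times_divide_eq_left)
  then show ?thesis by simp
qed

text \<open>The symmetric second difference of \<open>ln \<Gamma>\<close> about the midpoint of \<open>a\<close> and \<open>b\<close>.\<close>
definition ln_Gamma_gap :: "real \<Rightarrow> real \<Rightarrow> real" where
  "ln_Gamma_gap a b = ln_Gamma a + ln_Gamma b - 2 * ln_Gamma ((a + b) / 2)"

text \<open>
  The difference of the two sides is the second difference of \<open>s ln \<Gamma>(x) - ln \<Gamma>(s x)\<close>, whose second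
  derivative is \<open>s/x\<close> times \<open>x \<psi>'(x) - (s x) \<psi>'(s x) > 0\<close>.
\<close>
lemma ln_Gamma_gap_scaled_less:
  fixes s a b :: real
  assumes s: "s > 1" and pos: "a > 0" "b > 0" and "a \<noteq> b"
  shows "ln_Gamma_gap (s * a) (s * b) < s * ln_Gamma_gap a b"
  using pos \<open>a \<noteq> b\<close>
proof (induction a b rule: linorder_wlog)
  case (le a b)
  let ?f = "\<lambda>x. s * ln_Gamma x - ln_Gamma (s * x)"
  let ?f' = "\<lambda>x. s * (Digamma x - Digamma (s * x))"
  have "2 * ?f ((a + b) / 2) < ?f a + ?f b"
  proof (rule midpoint_less_if_deriv_strict_mono[where f' = ?f'])
    show "a < b" using le by simp
    show "(?f has_real_derivative ?f' x) (at x)" if "a \<le> x" for x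
      using that le s by (auto intro!: derivative_eq_intros simp: algebra_simps)
    fix x y assume xy: "a \<le> x" "x < y"
    show "?f' x < ?f' y"
    proof (rule DERIV_pos_imp_increasing[OF xy(2)])
      fix z assume "x \<le> z"
      with xy le have z: "z > 0" by simp
      have "(?f' has_real_derivative s * (Polygamma 1 z - s * Polygamma 1 (s * z))) (at z)"
        using z s nonpos_Ints_nonpos[of z] nonpos_Ints_nonpos[of "s * z"]
        by (force intro!: derivative_eq_intros simp: algebra_simps mult_le_0_iff)
      moreover have "(s * z) * Polygamma 1 (s * z) < z * Polygamma 1 z"
        using z s by (intro mult_trigamma_strict_antimono) auto
      then have "z * (s * Polygamma 1 (s * z)) < z * Polygamma 1 z"
        by (simp add: mult_ac)
      then have "s * Polygamma 1 (s * z) < Polygamma 1 z"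
        using z by simp
      ultimately show "\<exists>d. (?f' has_real_derivative d) (at z) \<and> d > 0"
        using s by (intro exI conjI) auto
    qed
  qed
  then show ?case by (simp add: ln_Gamma_gap_def algebra_simps)
next
  case (sym a b)
  then show ?case by (simp add: ln_Gamma_gap_def add_ac)
qed

section \<open>Power integrals by Tonelli's theorem\<close>

lemma nn_integral_Gamma_scaled:
  fixes a c :: real
  assumes a: "a > 0" and c: "c > 0"
  shows "(\<integral>\<^sup>+t. ennreal (t powr (a - 1) * exp (- (c * t))) * indicator {0<..} t \<partial>lborel)
       = ennreal (Gamma a * c powr (-a))"
proof -
  let ?h = "\<lambda>t. ennreal (t powr (a - 1) * exp (- t)) * indicator {0<..} t"
  have "ennreal (Gamma a) = (\<integral>\<^sup>+t. ?h t \<partial>lborel)"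
    unfolding Gamma_conv_nn_integral_real[OF a]
    by (intro nn_integral_cong_AE eventually_mono[OF AE_lborel_singleton[of 0]])
       (auto simp: indicator_def exp_minus field_simps)
  also have "\<dots> = ennreal c * (\<integral>\<^sup>+t. ?h (c * t) \<partial>lborel)"
    using c by (subst nn_integral_real_affine[where c = c and t = 0]) auto
  also have "(\<integral>\<^sup>+t. ?h (c * t) \<partial>lborel) = (\<integral>\<^sup>+t. ennreal (c powr (a - 1)) *
      (ennreal (t powr (a - 1) * exp (- (c * t))) * indicator {0<..} t) \<partial>lborel)"
    using c by (intro nn_integral_cong)
      (auto simp: indicator_def powr_mult ennreal_mult'[symmetric] zero_less_mult_iff mult_ac)
  also have "\<dots> = ennreal (c powr (a - 1)) *
      (\<integral>\<^sup>+t. ennreal (t powr (a - 1) * exp (- (c * t))) * indicator {0<..} t \<partial>lborel)"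
    (is "_ = _ * ?I") by (subst nn_integral_cmult) auto
  finally have "ennreal (c powr (-a)) * ennreal (Gamma a)
      = ennreal (c powr (-a) * (c * c powr (a - 1))) * ?I"
    using c by (simp add: ennreal_mult' mult.assoc)
  also have "c powr (-a) * (c * c powr (a - 1)) = 1"
    using c by (simp add: powr_diff powr_minus field_simps)
  finally show ?thesis
    using a c by (simp add: ennreal_mult' mult.commute)
qed

text \<open>The integrand is a multiple of the normal density with variance \<open>1/(2t)\<close>.\<close>
lemma nn_integral_exp_neg_square:
  fixes t :: real
  assumes t: "t > 0"
  shows "(\<integral>\<^sup>+x. ennreal (exp (- (t * x\<^sup>2))) \<partial>lborel) = ennreal (sqrt (pi / t))"
proof -
  define \<sigma> where "\<sigma> = sqrt (1 / (2 * t))"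
  have \<sigma>: "\<sigma> > 0" "\<sigma>\<^sup>2 = 1 / (2 * t)" using t by (auto simp: \<sigma>_def)
  interpret prob_space "density lborel (normal_density 0 \<sigma>)"
    by (rule prob_space_normal_density[OF \<sigma>(1)])
  have d: "normal_density 0 \<sigma> x = sqrt (t / pi) * exp (- (t * x\<^sup>2))" for x
    unfolding normal_density_def \<sigma>(2) using t by (simp add: real_sqrt_divide field_simps)
  have "1 = (\<integral>\<^sup>+x. ennreal (normal_density 0 \<sigma> x) \<partial>lborel)"
    using emeasure_space_1 by (simp add: emeasure_density)
  also have "\<dots> = ennreal (sqrt (t / pi)) * (\<integral>\<^sup>+x. ennreal (exp (- (t * x\<^sup>2))) \<partial>lborel)"
    (is "_ = _ * ?I") using t unfolding d by (simp add: ennreal_mult' nn_integral_cmult)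
  finally have "ennreal (sqrt (pi / t)) * 1 = ennreal (sqrt (pi / t)) * (ennreal (sqrt (t / pi)) * ?I)"
    by simp
  also have "\<dots> = ennreal (sqrt (pi / t) * sqrt (t / pi)) * ?I"
    using t by (simp add: ennreal_mult' mult.assoc)
  also have "sqrt (pi / t) * sqrt (t / pi) = 1"
    using t by (simp add: real_sqrt_mult[symmetric])
  finally show ?thesis by simp
qed

lemma ennreal_eq_divideI:
  assumes "ennreal c * I = ennreal d" "c > 0" "d \<ge> 0"
  shows "I = ennreal (d / c)"
proof -
  have "ennreal (1 / c) * ennreal c = 1"
    using assms(2) by (simp flip: ennreal_mult')
  then have "I = ennreal (1 / c) * ennreal c * I"
    by simp
  also have "\<dots> = ennreal (1 / c) * ennreal d"
    by (simp only: mult.assoc assms(1))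
  also have "\<dots> = ennreal (d / c)"
    using assms(2,3) by (simp flip: ennreal_mult')
  finally show ?thesis .
qed

text \<open>
  Multiply by \<open>\<Gamma>(a)\<close> and write \<open>\<Gamma>(a) (x\<^sup>2 + c\<^sup>2)\<^sup>-\<^sup>a\<close> as an integral over \<open>t\<close>. After exchanging the
  integrals, the one over \<open>x\<close> is Gaussian and contributes \<open>(\<pi>/t)\<^sup>1\<^sup>/\<^sup>2\<close>, which lowers the exponent of the
  remaining Gamma integral by \<open>1/2\<close>.
\<close>
lemma nn_integral_cauchy_powr:
  fixes a c :: real
  assumes a: "a > 1 / 2" and c: "c > 0"
  shows "(\<integral>\<^sup>+x. ennreal ((x\<^sup>2 + c\<^sup>2) powr (-a)) \<partial>lborel)
       = ennreal (sqrt pi * Gamma (a - 1 / 2) / Gamma a * c powr (1 - 2 * a))"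
proof -
  let ?k = "\<lambda>x t. ennreal (t powr (a - 1) * exp (- ((x\<^sup>2 + c\<^sup>2) * t))) * indicator {0<..} t"
  have p: "x\<^sup>2 + c\<^sup>2 > 0" for x using c by (simp add: add_nonneg_pos)
  have "ennreal (Gamma a) * (\<integral>\<^sup>+x. ennreal ((x\<^sup>2 + c\<^sup>2) powr (-a)) \<partial>lborel)
      = (\<integral>\<^sup>+x. ennreal (Gamma a * (x\<^sup>2 + c\<^sup>2) powr (-a)) \<partial>lborel)"
    using a by (simp add: nn_integral_cmult ennreal_mult')
  also have "\<dots> = (\<integral>\<^sup>+x. \<integral>\<^sup>+t. ?k x t \<partial>lborel \<partial>lborel)"
    using a p by (simp add: nn_integral_Gamma_scaled)
  also have "\<dots> = (\<integral>\<^sup>+t. \<integral>\<^sup>+x. ?k x t \<partial>lborel \<partial>lborel)"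
    by (rule lborel_pair.Fubini'[symmetric]) auto
  also have "\<dots> = (\<integral>\<^sup>+t. ennreal (sqrt pi) *
      (ennreal (t powr ((a - 1 / 2) - 1) * exp (- (c\<^sup>2 * t))) * indicator {0<..} t) \<partial>lborel)"
  proof (intro nn_integral_cong)
    fix t :: real
    show "(\<integral>\<^sup>+x. ?k x t \<partial>lborel) = ennreal (sqrt pi) *
      (ennreal (t powr ((a - 1 / 2) - 1) * exp (- (c\<^sup>2 * t))) * indicator {0<..} t)"
    proof (cases "t > 0")
      case True
      have "(\<integral>\<^sup>+x. ?k x t \<partial>lborel) = (\<integral>\<^sup>+x. ennreal (t powr (a - 1) * exp (- (c\<^sup>2 * t))) *
          ennreal (exp (- (t * x\<^sup>2))) \<partial>lborel)"
        using True by (intro nn_integral_cong)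
          (simp add: ennreal_mult'[symmetric] mult.assoc mult_exp_exp algebra_simps)
      also have "\<dots> = ennreal (t powr (a - 1) * exp (- (c\<^sup>2 * t)) * sqrt (pi / t))"
        using True by (simp add: nn_integral_cmult nn_integral_exp_neg_square ennreal_mult')
      also have "t powr (a - 1) * exp (- (c\<^sup>2 * t)) * sqrt (pi / t)
          = sqrt pi * (t powr ((a - 1) - 1 / 2) * exp (- (c\<^sup>2 * t)))"
        using True unfolding powr_diff[of t "a - 1"] by (simp add: real_sqrt_divide powr_half_sqrt)
      also have "(a - 1) - 1 / 2 = (a - 1 / 2) - 1" by simp
      finally show ?thesis using True by (simp add: ennreal_mult')
    qed simp
  qed
  also have "\<dots> = ennreal (sqrt pi * (Gamma (a - 1 / 2) * (c\<^sup>2) powr (- (a - 1 / 2))))"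
    using a c
    by (subst nn_integral_cmult, measurable, subst nn_integral_Gamma_scaled) (simp_all add: ennreal_mult')
  also have "(c\<^sup>2) powr (- (a - 1 / 2)) = c powr (1 - 2 * a)"
    using c by (simp add: powr_powr algebra_simps flip: powr_numeral)
  finally show ?thesis
    using ennreal_eq_divideI[of "Gamma a" _ "sqrt pi * (Gamma (a - 1 / 2) * c powr (1 - 2 * a))"] a
    by (simp add: mult_ac)
qed

text \<open>
  The same device for Euler's Beta integral on the half-line: with \<open>\<Gamma>(p + q) (y + 1)\<^sup>-\<^sup>p\<^sup>-\<^sup>q\<close>
  written as an integral over \<open>t\<close>, the integral over \<open>y\<close> is \<open>\<Gamma>(p) t\<^sup>-\<^sup>p\<close>.
\<close>
lemma nn_integral_Beta_half_line:
  fixes p q :: real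
  assumes p: "p > 0" and q: "q > 0"
  shows "(\<integral>\<^sup>+y. ennreal (y powr (p - 1) * (y + 1) powr (- (p + q))) * indicator {0<..} y \<partial>lborel)
       = ennreal (Gamma p * Gamma q / Gamma (p + q))"
proof -
  let ?k = "\<lambda>y t. ennreal (y powr (p - 1)) * indicator {0<..} y *
    (ennreal (t powr ((p + q) - 1) * exp (- ((y + 1) * t))) * indicator {0<..} t)"
  have "ennreal (Gamma (p + q)) * (\<integral>\<^sup>+y. ennreal (y powr (p - 1) * (y + 1) powr (- (p + q))) * indicator {0<..} y \<partial>lborel)
      = (\<integral>\<^sup>+y. ennreal (y powr (p - 1)) * indicator {0<..} y * ennreal (Gamma (p + q) * (y + 1) powr (- (p + q))) \<partial>lborel)"
    using p q by (subst nn_integral_cmult[symmetric])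
      (auto intro!: nn_integral_cong simp: ennreal_mult'[symmetric] indicator_def mult_ac)
  also have "\<dots> = (\<integral>\<^sup>+y. \<integral>\<^sup>+t. ?k y t \<partial>lborel \<partial>lborel)"
  proof (intro nn_integral_cong)
    fix y :: real
    show "ennreal (y powr (p - 1)) * indicator {0<..} y * ennreal (Gamma (p + q) * (y + 1) powr (- (p + q)))
        = (\<integral>\<^sup>+t. ?k y t \<partial>lborel)"
      using p q by (cases "y > 0") (simp_all add: nn_integral_cmult nn_integral_Gamma_scaled)
  qed
  also have "\<dots> = (\<integral>\<^sup>+t. \<integral>\<^sup>+y. ?k y t \<partial>lborel \<partial>lborel)"
    by (rule lborel_pair.Fubini'[symmetric]) auto
  also have "\<dots> = (\<integral>\<^sup>+t. ennreal (Gamma p) *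
      (ennreal (t powr (q - 1) * exp (- (1 * t))) * indicator {0<..} t) \<partial>lborel)"
  proof (intro nn_integral_cong)
    fix t :: real
    show "(\<integral>\<^sup>+y. ?k y t \<partial>lborel) = ennreal (Gamma p) *
      (ennreal (t powr (q - 1) * exp (- (1 * t))) * indicator {0<..} t)"
    proof (cases "t > 0")
      case True
      have "(\<integral>\<^sup>+y. ?k y t \<partial>lborel) = (\<integral>\<^sup>+y. ennreal (t powr (p + q - 1) * exp (- t)) *
          (ennreal (y powr (p - 1) * exp (- (t * y))) * indicator {0<..} y) \<partial>lborel)"
        using True by (intro nn_integral_cong)
          (simp add: ennreal_mult'[symmetric] indicator_def mult_exp_exp algebra_simps)
      also have "\<dots> = ennreal (t powr (p + q - 1) * exp (- t) * (Gamma p * t powr (-p)))"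
        by (subst nn_integral_cmult, measurable, subst nn_integral_Gamma_scaled[OF p True])
          (simp add: ennreal_mult')
      also have "t powr (p + q - 1) * exp (- t) * (Gamma p * t powr (-p))
          = Gamma p * (t powr (q - 1) * exp (- t))"
        using True by (simp add: powr_diff powr_add powr_minus field_simps)
      finally show ?thesis using True p by (simp add: ennreal_mult')
    qed simp
  qed
  also have "\<dots> = ennreal (Gamma p * Gamma q)"
    using p q
    by (subst nn_integral_cmult, measurable, subst nn_integral_Gamma_scaled) (simp_all add: ennreal_mult')
  finally show ?thesis
    using p q by (intro ennreal_eq_divideI) auto
qed

section \<open>The integrals over the half-plane\<close>

lemma measurable_Complex [measurable (raw)]:
  assumes [measurable]: "f \<in> borel_measurable M" "g \<in> borel_measurable M"
  shows "(\<lambda>x. Complex (f x) (g x)) \<in> borel_measurable M"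
  unfolding Complex_eq by measurable

lemma lborel_complex_eq_distr:
  "(lborel :: complex measure) = distr (lborel \<Otimes>\<^sub>M lborel) borel (\<lambda>(x, y). Complex x y)"
proof (rule lborel_eqI)
  fix l u :: complex
  assume le: "\<And>b. b \<in> Basis \<Longrightarrow> l \<bullet> b \<le> u \<bullet> b"
  have le': "Re l \<le> Re u" "Im l \<le> Im u"
    using le[of 1] le[of \<i>] by (auto simp: Basis_complex_def)
  have "(\<lambda>(x, y). Complex x y) -` box l u \<inter> space (lborel \<Otimes>\<^sub>M lborel)
      = {Re l<..<Re u} \<times> {Im l<..<Im u}"
    by (auto simp: box_def Basis_complex_def space_pair_measure)
  then show "emeasure (distr (lborel \<Otimes>\<^sub>M lborel) borel (\<lambda>(x, y). Complex x y)) (box l u)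
      = (\<Prod>b\<in>Basis. (u - l) \<bullet> b)"
    using le' by (simp add: emeasure_distr lborel.emeasure_pair_measure_Times
        Basis_complex_def ennreal_mult')
qed simp

lemma nn_integral_complex:
  assumes [measurable]: "f \<in> borel_measurable borel"
  shows "(\<integral>\<^sup>+z. f z \<partial>(lborel :: complex measure)) = (\<integral>\<^sup>+y. \<integral>\<^sup>+x. f (Complex x y) \<partial>lborel \<partial>lborel)"
  unfolding lborel_complex_eq_distr
  by (subst nn_integral_distr) (auto simp: lborel_pair.nn_integral_snd[symmetric] case_prod_unfold)

lemma Gamma_legendre_duplication_real:
  fixes x :: real
  assumes x: "x > 0"
  shows "Gamma x * Gamma (x + 1 / 2) = 2 powr (1 - 2 * x) * sqrt pi * Gamma (2 * x)"
proof -
  have e: "complex_of_real x + 1 / 2 = complex_of_real (x + 1 / 2)"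
    "2 * complex_of_real x = complex_of_real (2 * x)"
    "exp ((1 - complex_of_real (2 * x)) * complex_of_real (ln 2))
      = complex_of_real (2 powr (1 - 2 * x))"
    by (simp_all add: powr_def flip: exp_of_real)
  have "complex_of_real x \<notin> \<int>\<^sub>\<le>\<^sub>0" "complex_of_real (x + 1 / 2) \<notin> \<int>\<^sub>\<le>\<^sub>0"
    using x nonpos_Ints_nonpos[of x] nonpos_Ints_nonpos[of "x + 1 / 2"]
    unfolding of_real_in_nonpos_Ints_iff by linarith+
  then have "complex_of_real (Gamma x) * complex_of_real (Gamma (x + 1 / 2))
      = complex_of_real (2 powr (1 - 2 * x)) * complex_of_real (sqrt pi) * complex_of_real (Gamma (2 * x))"
    using Gamma_legendre_duplication[of "complex_of_real x"]
    unfolding e Gamma_complex_of_real by blast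
  then show ?thesis by (simp only: of_real_eq_iff flip: of_real_mult)
qed

text \<open>
  Integrating over the horizontal line at height \<open>y\<close> leaves a constant times
  \<open>y\<^sup>2\<^sup>s\<^sup>-\<^sup>2 (y + 1)\<^sup>1\<^sup>-\<^sup>2\<^sup>r\<^sup>s\<close>, a Beta integral with parameters \<open>2s - 1\<close> and \<open>2s(r - 1)\<close>.
  Duplication at \<open>rs - 1/2\<close> merges \<open>\<Gamma>(rs - 1/2)/\<Gamma>(rs)\<close> with \<open>1/\<Gamma>(2rs - 1)\<close> into \<open>1/\<Gamma>(rs)\<^sup>2\<close>. The value
  \<open>s = 1\<close> is included because it gives the integral on the right-hand side of the inequality.
\<close>
lemma nn_integral_lhs_integrand:
  assumes r: "r > 1" and s: "s \<ge> 1"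
  shows "(\<integral>\<^sup>+z. ennreal (lhs_integrand r s z) * indicator upper_half_plane z \<partial>lborel)
       = ennreal (pi * 2 powr (2 - 2 * r * s) / (2 * s - 1) *
           exp (ln_Gamma_gap (s * 2) (s * (2 * r - 2))))"
proof -
  let ?a = "r * s"
  have a: "?a > s" "?a > 1" using r s by (auto intro: less_le_trans[of _ r] simp: less_1_mult')
  let ?J = "sqrt pi * Gamma (?a - 1 / 2) / Gamma ?a"
  have [measurable]: "upper_half_plane \<in> sets borel"
    unfolding upper_half_plane_def by measurable
  have "(\<integral>\<^sup>+z. ennreal (lhs_integrand r s z) * indicator upper_half_plane z \<partial>lborel)
      = (\<integral>\<^sup>+y. \<integral>\<^sup>+x. ennreal (lhs_integrand r s (Complex x y)) *
          indicator upper_half_plane (Complex x y) \<partial>lborel \<partial>lborel)"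
    unfolding lhs_integrand_def by (rule nn_integral_complex) measurable
  also have "\<dots> = (\<integral>\<^sup>+y. ennreal ?J * (ennreal (y powr ((2 * s - 1) - 1) *
      (y + 1) powr (- ((2 * s - 1) + 2 * s * (r - 1)))) * indicator {0<..} y) \<partial>lborel)"
  proof (intro nn_integral_cong)
    fix y :: real
    show "(\<integral>\<^sup>+x. ennreal (lhs_integrand r s (Complex x y)) *
          indicator upper_half_plane (Complex x y) \<partial>lborel)
      = ennreal ?J * (ennreal (y powr ((2 * s - 1) - 1) *
      (y + 1) powr (- ((2 * s - 1) + 2 * s * (r - 1)))) * indicator {0<..} y)"
    proof (cases "y > 0")
      case True
      have "(\<integral>\<^sup>+x. ennreal (lhs_integrand r s (Complex x y)) *
          indicator upper_half_plane (Complex x y) \<partial>lborel)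
        = (\<integral>\<^sup>+x. ennreal (y powr (2 * s - 2)) * ennreal ((x\<^sup>2 + (y + 1)\<^sup>2) powr (- ?a)) \<partial>lborel)"
      proof (intro nn_integral_cong)
        fix x :: real
        have "x\<^sup>2 + (y + 1)\<^sup>2 > 0" using True by (simp add: add_nonneg_pos)
        then have "cmod (Complex x (y + 1)) powr (2 * r * s) = (x\<^sup>2 + (y + 1)\<^sup>2) powr ?a"
          by (simp add: cmod_def powr_powr flip: powr_half_sqrt)
        then show "ennreal (lhs_integrand r s (Complex x y)) *
            indicator upper_half_plane (Complex x y)
          = ennreal (y powr (2 * s - 2)) * ennreal ((x\<^sup>2 + (y + 1)\<^sup>2) powr (- ?a))"
          using True by (simp add: lhs_integrand_def upper_half_plane_def powr_minus
              divide_inverse ennreal_mult')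
      qed
      also have "\<dots> = ennreal (y powr (2 * s - 2)) * ennreal (?J * (y + 1) powr (1 - 2 * ?a))"
        using True a by (subst nn_integral_cmult) (auto simp: nn_integral_cauchy_powr)
      also have "1 - 2 * ?a = - ((2 * s - 1) + 2 * s * (r - 1))" by (simp add: algebra_simps)
      finally show ?thesis using True a by (simp add: mult_ac flip: ennreal_mult')
    qed (simp add: upper_half_plane_def)
  qed
  also have "\<dots> = ennreal (?J * (Gamma (2 * s - 1) * Gamma (2 * s * (r - 1))
      / Gamma ((2 * s - 1) + 2 * s * (r - 1))))"
    using a s r
    by (subst nn_integral_cmult, measurable, subst nn_integral_Beta_half_line)
       (simp_all flip: ennreal_mult')
  also have "?J * (Gamma (2 * s - 1) * Gamma (2 * s * (r - 1))
      / Gamma ((2 * s - 1) + 2 * s * (r - 1)))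
    = pi * 2 powr (2 - 2 * r * s) / (2 * s - 1) * exp (ln_Gamma_gap (s * 2) (s * (2 * r - 2)))"
  proof -
    have e: "(2 * s - 1) + 2 * s * (r - 1) = 2 * (?a - 1 / 2)" by (simp add: algebra_simps)
    have "Gamma (?a - 1 / 2) * Gamma ?a
        = 2 powr (2 - 2 * r * s) * sqrt pi * Gamma (2 * (?a - 1 / 2))"
      using Gamma_legendre_duplication_real[of "?a - 1 / 2"] a by (simp add: algebra_simps)
    moreover have G: "Gamma (2 * (?a - 1 / 2)) > 0" "Gamma ?a > 0"
      using a by (intro Gamma_real_pos; simp)+
    ultimately have "Gamma (?a - 1 / 2)
        = 2 powr (2 - 2 * r * s) * sqrt pi * Gamma (2 * (?a - 1 / 2)) / Gamma ?a"
      by (simp add: eq_divide_eq)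
    then have "?J = pi * 2 powr (2 - 2 * r * s) * Gamma (2 * (?a - 1 / 2)) / (Gamma ?a)\<^sup>2"
      by (simp add: power2_eq_square)
    moreover have "Gamma (s * 2) = (2 * s - 1) * Gamma (2 * s - 1)"
      using Gamma_plus1[of "2 * s - 1"] nonpos_Ints_nonpos[of "2 * s - 1"] s
      by (force simp: mult.commute)
    moreover have "exp (ln_Gamma_gap (s * 2) (s * (2 * r - 2)))
        = Gamma (s * 2) * Gamma (2 * s * (r - 1)) / (Gamma ?a)\<^sup>2"
    proof -
      have m: "(s * 2 + s * (2 * r - 2)) / 2 = ?a" "s * (2 * r - 2) = 2 * s * (r - 1)"
        by (simp_all add: algebra_simps)
      have "2 * s * (r - 1) > 0" "s * 2 > 0" using r s by simp_all
      then show ?thesis using a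
        unfolding ln_Gamma_gap_def m(1) unfolding m(2)
        by (simp add: exp_diff exp_add exp_double Gamma_real_pos_exp)
    qed
    ultimately show ?thesis unfolding e using G s by simp
  qed
  finally show ?thesis .
qed

section \<open>The inequality and its equality case\<close>

lemma set_integral_eq_if_nn_integral_eq:
  fixes f :: "'a \<Rightarrow> real"
  assumes "set_borel_measurable M A f" and "\<And>z. z \<in> A \<Longrightarrow> f z \<ge> 0" and "v \<ge> 0"
    and "(\<integral>\<^sup>+z. ennreal (f z) * indicator A z \<partial>M) = ennreal v"
  shows "set_integrable M A f" and "(LINT z:A|M. f z) = v"
proof -
  have "(\<integral>\<^sup>+z. ennreal (indicator A z *\<^sub>R f z) \<partial>M) = ennreal v"
    unfolding assms(4)[symmetric] by (intro nn_integral_cong) (simp add: indicator_def)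
  then have "has_bochner_integral M (\<lambda>z. indicator A z *\<^sub>R f z) v"
    using assms(1-3) by (intro has_bochner_integral_nn_integral)
      (auto simp: set_borel_measurable_def indicator_def)
  then show "set_integrable M A f" "(LINT z:A|M. f z) = v"
    unfolding set_integrable_def set_lebesgue_integral_def
    by (simp_all add: has_bochner_integral_iff)
qed

theorem theorem1p3:
  fixes r s :: real
  assumes "r > 1" and "s > 1"
  shows "set_integrable lborel upper_half_plane (lhs_integrand r s) \<and>
         set_integrable lborel upper_half_plane (rhs_integrand r) \<and>
         (LINT z:upper_half_plane|lborel. lhs_integrand r s z)
           \<le> C_const s * (LINT z:upper_half_plane|lborel. rhs_integrand r z) powr s \<and>
         ((LINT z:upper_half_plane|lborel. lhs_integrand r s z)
           = C_const s * (LINT z:upper_half_plane|lborel. rhs_integrand r z) powr s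
          \<longleftrightarrow> r = 2)"
proof -
  have [measurable]: "upper_half_plane \<in> sets borel"
    unfolding upper_half_plane_def by measurable
  let ?g = "ln_Gamma_gap 2 (2 * r - 2)"
  let ?gs = "ln_Gamma_gap (s * 2) (s * (2 * r - 2))"
  let ?K = "pi * 2 powr (2 - 2 * r * s) / (2 * s - 1)"
  have L: "set_integrable lborel upper_half_plane (lhs_integrand r s)"
    "(LINT z:upper_half_plane|lborel. lhs_integrand r s z) = ?K * exp ?gs"
    using assms
    by (intro set_integral_eq_if_nn_integral_eq[OF _ _ _ nn_integral_lhs_integrand[of r s]];
        simp add: set_borel_measurable_def lhs_integrand_def[abs_def])+
  have "(\<integral>\<^sup>+z. ennreal (rhs_integrand r z) * indicator upper_half_plane z \<partial>lborel)
      = (\<integral>\<^sup>+z. ennreal (lhs_integrand r 1 z) * indicator upper_half_plane z \<partial>lborel)"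
    by (intro nn_integral_cong)
      (auto simp: lhs_integrand_def rhs_integrand_def upper_half_plane_def indicator_def)
  also have "\<dots> = ennreal (pi * 2 powr (2 - 2 * r) * exp ?g)"
    using nn_integral_lhs_integrand[of r 1] assms by simp
  finally have N: "(\<integral>\<^sup>+z. ennreal (rhs_integrand r z) * indicator upper_half_plane z \<partial>lborel)
      = ennreal (pi * 2 powr (2 - 2 * r) * exp ?g)" .
  have R: "set_integrable lborel upper_half_plane (rhs_integrand r)"
    "(LINT z:upper_half_plane|lborel. rhs_integrand r z) = pi * 2 powr (2 - 2 * r) * exp ?g"
    by (intro set_integral_eq_if_nn_integral_eq[OF _ _ _ N];
        simp add: set_borel_measurable_def rhs_integrand_def[abs_def])+
  have K: "?K > 0" using assms by simp
  \<comment> \<open>The prefactor \<open>?K\<close> agrees on both sides: this is what fixes the constant \<open>C_const\<close>.\<close>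
  have CR: "C_const s * (pi * 2 powr (2 - 2 * r) * exp ?g) powr s = ?K * exp (s * ?g)"
  proof -
    have "(pi * 2 powr (2 - 2 * r) * exp ?g) powr s
        = pi powr s * 2 powr ((2 - 2 * r) * s) * exp (s * ?g)"
      by (simp add: powr_mult powr_powr exp_powr_real mult.commute)
    then have "C_const s * (pi * 2 powr (2 - 2 * r) * exp ?g) powr s
        = (pi powr (1 - s) * pi powr s) * (2 powr ((2 - 2 * r) * s) / 2 powr (2 * s - 2))
            / (2 * s - 1) * exp (s * ?g)"
      by (simp add: C_const_def mult_ac)
    also have "pi powr (1 - s) * pi powr s = pi"
      by (simp flip: powr_add)
    also have "2 powr ((2 - 2 * r) * s) / 2 powr (2 * s - 2) = 2 powr (2 - 2 * r * s)"
      by (simp add: algebra_simps flip: powr_diff)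
    finally show ?thesis .
  qed
  have lt: "?gs < s * ?g" if "r \<noteq> 2"
    using that assms by (intro ln_Gamma_gap_scaled_less) auto
  have eq: "?gs = s * ?g" if "r = 2"
    using that by (simp add: ln_Gamma_gap_def mult.commute)
  have "exp ?gs \<le> exp (s * ?g)" "exp ?gs = exp (s * ?g) \<longleftrightarrow> r = 2"
    unfolding exp_le_cancel_iff exp_inj_iff using lt eq by (cases "r = 2"; force)+
  then have "?K * exp ?gs \<le> ?K * exp (s * ?g)" "?K * exp ?gs = ?K * exp (s * ?g) \<longleftrightarrow> r = 2"
    using K by (simp_all only: mult_le_cancel_left_pos mult_cancel_left) auto
  then show ?thesis
    using L R(1) unfolding L(2) R(2) CR by blast
qed

end
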